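(* For a finite simple chordal outerplanar graph $G$ with maximum degree $\Delta \in \{2,3\}$, we have $\omega(G^2) = \chi(G^2) = \mathrm{ind}(G^2) + 1 = \Delta + 1$.
   Context: $G^2$ is the graph on $V(G)$ in which two distinct vertices are adjacent iff their distance in $G$ is 1 or 2; $\omega$ is the clique number, $\chi$ the chromatic number, and $\mathrm{ind}(H) = \max\{\delta(H') : H' \text{ an induced subgraph of } H\}$ the inductiveness, $\delta$ denoting minimum degree. *)

theory Defs
  imports "HOL-Analysis.Analysis" "HOL-Library.Extended_Nat"
begin

text \<open>A graph is given by a vertex set and a set of edges, each edge being an unordered pair
  of distinct vertices.\<close>

definition simple_graph :: "'a set \<Rightarrow> 'a set set \<Rightarrow> bool" where
  "simple_graph V E \<longleftrightarrow> (\<forall>e\<in>E. e \<subseteq> V \<and> card e = 2)"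

definition vdegree :: "'a set set \<Rightarrow> 'a \<Rightarrow> nat" where
  "vdegree E v = card {u. {v, u} \<in> E}"

text \<open>For finite nonempty \<open>V\<close> the supremum is the maximum; the graph without vertices gets
  maximum degree \<open>0\<close>.\<close>

definition max_degree :: "'a set \<Rightarrow> 'a set set \<Rightarrow> nat" where
  "max_degree V E = (SUP v\<in>V. vdegree E v)"

definition min_degree :: "'a set \<Rightarrow> 'a set set \<Rightarrow> nat" where
  "min_degree V E = Min (vdegree E ` V)"

definition induced_edges :: "'a set set \<Rightarrow> 'a set \<Rightarrow> 'a set set" where
  "induced_edges E W = {e \<in> E. e \<subseteq> W}"

definition inductiveness :: "'a set \<Rightarrow> 'a set set \<Rightarrow> nat" where
  "inductiveness V E = Max {min_degree W (induced_edges E W) | W. W \<subseteq> V \<and> W \<noteq> {}}"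

definition is_clique :: "'a set \<Rightarrow> 'a set set \<Rightarrow> 'a set \<Rightarrow> bool" where
  "is_clique V E K \<longleftrightarrow> K \<subseteq> V \<and> (\<forall>u\<in>K. \<forall>v\<in>K. u \<noteq> v \<longrightarrow> {u, v} \<in> E)"

definition clique_number :: "'a set \<Rightarrow> 'a set set \<Rightarrow> nat" where
  "clique_number V E = Max {card K | K. is_clique V E K}"

definition proper_coloring :: "'a set \<Rightarrow> 'a set set \<Rightarrow> nat \<Rightarrow> ('a \<Rightarrow> nat) \<Rightarrow> bool" where
  "proper_coloring V E k c \<longleftrightarrow>
     c ` V \<subseteq> {..<k} \<and> (\<forall>u\<in>V. \<forall>v\<in>V. {u, v} \<in> E \<longrightarrow> c u \<noteq> c v)"

definition chromatic_number :: "'a set \<Rightarrow> 'a set set \<Rightarrow> nat" where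
  "chromatic_number V E = (LEAST k. \<exists>c. proper_coloring V E k c)"

text \<open>A path is the list of its vertices; its length as a path is the number of its edges.\<close>

definition is_path :: "'a set \<Rightarrow> 'a set set \<Rightarrow> 'a list \<Rightarrow> bool" where
  "is_path V E p \<longleftrightarrow> p \<noteq> [] \<and> distinct p \<and> set p \<subseteq> V \<and>
     (\<forall>i. Suc i < length p \<longrightarrow> {p ! i, p ! Suc i} \<in> E)"

definition graph_dist :: "'a set \<Rightarrow> 'a set set \<Rightarrow> 'a \<Rightarrow> 'a \<Rightarrow> enat" where
  "graph_dist V E u v =
     (INF p\<in>{p. is_path V E p \<and> hd p = u \<and> last p = v}. enat (length p - 1))"

definition square_edges :: "'a set \<Rightarrow> 'a set set \<Rightarrow> 'a set set" where
  "square_edges V E =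
     {{u, v} | u v. u \<in> V \<and> v \<in> V \<and> u \<noteq> v \<and> graph_dist V E u v \<in> {1, 2}}"

definition cycle_edges :: "'a list \<Rightarrow> 'a set set" where
  "cycle_edges c = {{c ! i, c ! (Suc i mod length c)} | i. i < length c}"

definition is_cycle :: "'a set set \<Rightarrow> 'a list \<Rightarrow> bool" where
  "is_cycle E c \<longleftrightarrow> 3 \<le> length c \<and> distinct c \<and> cycle_edges c \<subseteq> E"

definition chordal :: "'a set set \<Rightarrow> bool" where
  "chordal E \<longleftrightarrow>
     (\<forall>c. is_cycle E c \<and> 4 \<le> length c \<longrightarrow> (\<exists>e\<in>E. e \<subseteq> set c \<and> e \<notin> cycle_edges c))"

text \<open>Plane embedding: vertices are distinct points, each edge is an arc joining its endpoints
  and meeting no further vertex, and two distinct edges meet only in common endpoints.\<close>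

definition plane_embedding ::
    "'a set \<Rightarrow> 'a set set \<Rightarrow> ('a \<Rightarrow> complex) \<Rightarrow> ('a set \<Rightarrow> real \<Rightarrow> complex) \<Rightarrow> bool" where
  "plane_embedding V E p \<gamma> \<longleftrightarrow>
     inj_on p V \<and>
     (\<forall>e\<in>E. arc (\<gamma> e) \<and> {pathstart (\<gamma> e), pathfinish (\<gamma> e)} = p ` e \<and>
             path_image (\<gamma> e) \<inter> p ` V = p ` e) \<and>
     (\<forall>e\<in>E. \<forall>f\<in>E. e \<noteq> f \<longrightarrow> path_image (\<gamma> e) \<inter> path_image (\<gamma> f) = p ` (e \<inter> f))"

definition drawing ::
    "'a set \<Rightarrow> 'a set set \<Rightarrow> ('a \<Rightarrow> complex) \<Rightarrow> ('a set \<Rightarrow> real \<Rightarrow> complex) \<Rightarrow> complex set" where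
  "drawing V E p \<gamma> = p ` V \<union> (\<Union>e\<in>E. path_image (\<gamma> e))"

text \<open>The drawing of a finite graph is compact, so \<open>outside\<close> of it is its unbounded face.\<close>

definition outerplanar :: "'a set \<Rightarrow> 'a set set \<Rightarrow> bool" where
  "outerplanar V E \<longleftrightarrow>
     (\<exists>p \<gamma>. plane_embedding V E p \<gamma> \<and> p ` V \<subseteq> frontier (outside (drawing V E p \<gamma>)))"

end

theory Submission
  imports Defs
begin

text \<open>
  The closed neighbourhood of a vertex of degree \<open>\<Delta>\<close> is a clique of \<open>G\<^sup>2\<close>, so by
  greedy colouring it suffices that every nonempty \<open>W\<close> contains a vertex of degree at most
  \<open>\<Delta>\<close> in \<open>G\<^sup>2[W]\<close>. Layer a component by the distance from a root in \<open>W\<close> and let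
  \<open>v \<in> W\<close> be deepest. Chordality makes two vertices of a layer adjacent as soon as a walk through
  deeper layers joins them; together with \<open>\<Delta> \<le> 3\<close> this forces every vertex that has distance at
  most \<open>2\<close> from \<open>v\<close> and is not deeper than \<open>v\<close> into the closed neighbourhood of any one
  parent \<open>p\<close> of \<open>v\<close>, and \<open>v\<close> itself is a neighbour of \<open>p\<close>.
\<close>

section \<open>Chordless walks and chords of cycles\<close>

text \<open>A shortest walk among those with the ends of \<open>p\<close> and vertices in
  \<open>set p\<close> works: a repeated vertex or a chord would allow a shortcut.\<close>

lemma induced_walk_exists:
  assumes "p \<noteq> []" "successively (\<lambda>u v. {u, v} \<in> E) p"
  obtains q where "q \<noteq> []" "successively (\<lambda>u v. {u, v} \<in> E) q" "hd q = hd p" "last q = last p"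
    "set q \<subseteq> set p" "distinct q"
    "\<And>i j. i < j \<Longrightarrow> j < length q \<Longrightarrow> {q ! i, q ! j} \<in> E \<Longrightarrow> j = Suc i"
proof -
  let ?adj = "\<lambda>u v. {u, v} \<in> E"
  let ?P = "\<lambda>q. q \<noteq> [] \<and> successively ?adj q \<and> hd q = hd p \<and> last q = last p \<and> set q \<subseteq> set p"
  obtain q where q: "?P q" and least: "\<And>q'. ?P q' \<Longrightarrow> length q \<le> length q'"
    using ex_has_least_nat[of ?P p length] assms by blast
  have suc_drop: "successively ?adj (drop n q)" and suc_take: "successively ?adj (take n q)" for n
    using q successively_append_iff[of ?adj "take n q" "drop n q"] by auto
  have "distinct q"
  proof (rule ccontr)
    assume "\<not> distinct q"
    then obtain i j where ij: "i < j" "j < length q" "q ! i = q ! j"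
      by (metis distinct_conv_nth nat_neq_iff)
    let ?q = "take i q @ drop j q"
    have "hd ?q = hd q"
    proof (cases i)
      \<comment> \<open>Here the prefix is empty and the new head is \<open>q ! j\<close>, which
        equals \<open>q ! 0\<close>.\<close>
      case 0
      then show ?thesis
        using ij q hd_conv_nth[of q] by (auto simp: hd_drop_conv_nth)
    next
      case (Suc m)
      then show ?thesis
        using q by (cases q) auto
    qed
    moreover have "successively ?adj ?q"
    proof (cases i)
      case (Suc m)
      then have "?adj (q ! m) (q ! i)"
        using q ij successively_conv_nth[of ?adj q] by (metis Suc_lessD less_trans)
      moreover have "last (take i q) = q ! m"
        using ij q Suc by (subst last_conv_nth) auto
      ultimately show ?thesis
        using ij suc_drop[of j] suc_take[of i]
        by (simp add: successively_append_iff hd_drop_conv_nth)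
    qed (simp add: suc_drop)
    moreover have "set ?q \<subseteq> set p"
      using q set_take_subset[of i q] set_drop_subset[of j q] by auto
    ultimately have "?P ?q"
      using q ij by auto
    then show False
      using least[of ?q] ij by simp
  qed
  moreover have "j = Suc i" if ij: "i < j" "j < length q" "{q ! i, q ! j} \<in> E" for i j
  proof (rule ccontr)
    assume "j \<noteq> Suc i"
    \<comment> \<open>This jumps along the chord from \<open>q ! i\<close> to \<open>q ! j\<close>
      and is shorter because \<open>j\<close> is not \<open>Suc i\<close>.\<close>
    let ?q = "take (Suc i) q @ drop j q"
    have "hd ?q = hd q"
      using q by (cases q) auto
    moreover have "successively ?adj ?q"
    proof -
      have "last (take (Suc i) q) = q ! i"
        using ij q by (subst last_conv_nth) auto
      then show ?thesis
        using ij suc_drop[of j] suc_take[of "Suc i"]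
        by (simp add: successively_append_iff hd_drop_conv_nth)
    qed
    moreover have "set ?q \<subseteq> set p"
      using q set_take_subset[of "Suc i" q] set_drop_subset[of j q] by auto
    ultimately have "?P ?q"
      using q ij by auto
    then show False
      using least[of ?q] ij \<open>j \<noteq> Suc i\<close> by simp
  qed
  ultimately show thesis
    using q by (intro that[of q]) simp_all
qed

text \<open>The chord is given by list positions so that applications to concatenated lists can
  split on where its ends lie. The two inequalities exclude the cycle edges, the second one the
  closing edge.\<close>

lemma chordal_cycle_chord:
  assumes "chordal E" and card2: "\<And>e. e \<in> E \<Longrightarrow> card e = 2"
    and c: "distinct c" "4 \<le> length c" "successively (\<lambda>u v. {u, v} \<in> E) c" "{last c, hd c} \<in> E"
  obtains i j where "i < j" "j < length c" "j \<noteq> Suc i" "\<not> (i = 0 \<and> Suc j = length c)"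
    "{c ! i, c ! j} \<in> E"
proof -
  have ne: "c \<noteq> []" using c by auto
  have "{c ! i, c ! (Suc i mod length c)} \<in> E" if "i < length c" for i
  proof (cases "Suc i = length c")
    case True
    then show ?thesis
      using c(4) ne by (simp add: last_conv_nth hd_conv_nth flip: True)
  next
    case False
    then show ?thesis
      using c(3) that by (simp add: successively_conv_nth)
  qed
  then have "is_cycle E c"
    using c by (auto simp: is_cycle_def cycle_edges_def)
  then obtain e where e: "e \<in> E" "e \<subseteq> set c" "e \<notin> cycle_edges c"
    using assms unfolding chordal_def by blast
  obtain a b where ab: "e = {a, b}" "a \<noteq> b"
    using card2[OF e(1)] by (auto simp: card_2_iff)
  obtain i j where ij: "i < j" "j < length c" "e = {c ! i, c ! j}"
  proof -
    obtain m n where "m < length c" "c ! m = a" "n < length c" "c ! n = b"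
      using e(2) ab by (auto simp: in_set_conv_nth)
    then show thesis
      using that[of m n] that[of n m] ab by (metis insert_commute nat_neq_iff)
  qed
  have "j \<noteq> Suc i"
    using e(3) ij unfolding cycle_edges_def by (auto intro!: exI[of _ i])
  moreover have "\<not> (i = 0 \<and> Suc j = length c)"
  proof
    assume "i = 0 \<and> Suc j = length c"
    then have "e = {c ! j, c ! (Suc j mod length c)}"
      using ij by auto
    then show False
      using e(3) ij unfolding cycle_edges_def by blast
  qed
  ultimately show thesis
    using that ij e(1) by blast
qed

section \<open>Layerings and walks through deeper layers\<close>

text \<open>The layering abstracts the distance from a root inside one connected component \<open>C\<close>.\<close>

locale chordal_layering =
  fixes E :: "'a set set" and C :: "'a set" and L :: "'a \<Rightarrow> nat"
  assumes chordal: "chordal E"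
    and card_edge: "\<And>e. e \<in> E \<Longrightarrow> card e = 2"
    and closed: "\<And>u v. u \<in> C \<Longrightarrow> {u, v} \<in> E \<Longrightarrow> v \<in> C"
    and layer_Suc: "\<And>u v. u \<in> C \<Longrightarrow> {u, v} \<in> E \<Longrightarrow> L v \<le> Suc (L u)"
    and parent: "\<And>u. u \<in> C \<Longrightarrow> L u \<noteq> 0 \<Longrightarrow> \<exists>w. {u, w} \<in> E \<and> Suc (L w) = L u"
    and root: "\<And>u v. u \<in> C \<Longrightarrow> v \<in> C \<Longrightarrow> L u = 0 \<Longrightarrow> L v = 0 \<Longrightarrow> u = v"
begin

lemma adjacent_neq: "{u, v} \<in> E \<Longrightarrow> u \<noteq> v"
  using card_edge[of "{u, v}"] by auto

lemma adjacent_sym: "{u, v} \<in> E \<Longrightarrow> {v, u} \<in> E"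
  by (simp add: insert_commute)

lemma layer_Suc': "u \<in> C \<Longrightarrow> {u, v} \<in> E \<Longrightarrow> L u \<le> Suc (L v)"
  by (rule layer_Suc[OF closed adjacent_sym])

text \<open>Otherwise a shortest such walk, closed up through the parents of its ends, is a chordless
  cycle: the parents are equal or adjacent by induction, and they have no neighbour in the interior
  of the walk.\<close>

lemma layer_walk_adjacent:
  assumes "p \<noteq> []" "successively (\<lambda>u v. {u, v} \<in> E) p" "hd p \<in> C" "last p \<in> C"
    and "L (hd p) = k" "L (last p) = k"
    and "\<forall>z\<in>set p. z = hd p \<or> z = last p \<or> z \<in> C \<and> k < L z"
    and "hd p \<noteq> last p"
  shows "{hd p, last p} \<in> E"
  using assms
proof (induction k arbitrary: p)
  case 0
  \<comment> \<open>Layer 0 has only one vertex, so the ends would coincide.\<close>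
  then show ?case using root by blast
next
  case (Suc k)
  let ?x = "hd p" and ?y = "last p"
  show ?case
  proof (rule ccontr)
    assume nonadj: "{?x, ?y} \<notin> E"
    obtain q where q: "q \<noteq> []" "successively (\<lambda>u v. {u, v} \<in> E) q" "hd q = ?x" "last q = ?y"
        "set q \<subseteq> set p" "distinct q"
      and induced: "\<And>i j. i < j \<Longrightarrow> j < length q \<Longrightarrow> {q ! i, q ! j} \<in> E \<Longrightarrow> j = Suc i"
      using induced_walk_exists Suc.prems(1,2) by metis
    have len: "3 \<le> length q"
    proof (rule ccontr)
      assume "\<not> 3 \<le> length q"
      then consider a where "q = [a]" | a b where "q = [a, b]"
        using q(1) by (cases q; cases "tl q") (auto simp: Suc_le_eq)
      then show False
        using q(2-4) Suc.prems(8) nonadj by cases auto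
    qed
    have ends: "q ! 0 = ?x" "q ! (length q - 1) = ?y"
      using q by (metis hd_conv_nth, metis last_conv_nth)
    have layer_q: "Suc k \<le> L z" "z \<in> C" if "z \<in> set q" for z
      using that q(5) Suc.prems(3-7) by (metis less_imp_le order_refl subsetD)+
    have interior: "Suc k < L (q ! i)" if "0 < i" "Suc i < length q" for i
    proof -
      have "q ! i \<noteq> ?x" "q ! i \<noteq> ?y"
        using that q(1,6) unfolding ends[symmetric] by (auto simp: nth_eq_iff_index_eq)
      moreover have "q ! i \<in> set p"
        using that q(5) by (meson Suc_lessD nth_mem subsetD)
      ultimately show ?thesis
        using Suc.prems(7) by blast
    qed
    \<comment> \<open>A common parent closes \<open>q\<close> up to a cycle of length at least 4. As
      \<open>q\<close> is induced, a chord must join \<open>w\<close> to an interior vertex of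
      \<open>q\<close>, but these are at least two layers apart.\<close>
    have no_common_parent: False if w: "{?x, w} \<in> E" "{?y, w} \<in> E" "L w = k" for w
    proof -
      let ?c = "q @ [w]"
      have "w \<notin> set q"
        using layer_q(1)[of w] w(3) by auto
      then have "distinct ?c" using q by simp
      moreover have "successively (\<lambda>u v. {u, v} \<in> E) ?c"
        using q w by (simp add: successively_append_iff)
      moreover have "{last ?c, hd ?c} \<in> E"
        using q w by (simp add: insert_commute)
      ultimately obtain i j where ij: "i < j" "j < length ?c" "j \<noteq> Suc i"
          "\<not> (i = 0 \<and> Suc j = length ?c)" "{?c ! i, ?c ! j} \<in> E"
        using chordal_cycle_chord[OF chordal card_edge, of ?c] len by auto
      show False
      proof (cases "j < length q")
        case True
        then show False using ij induced[of i j] by (simp add: nth_append)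
      next
        case False
        then have "{q ! i, w} \<in> E" "0 < i" "Suc i < length q"
          using ij by (auto simp: nth_append split: if_splits)
        then show False
          using interior[of i] layer_Suc'[of "q ! i" w] layer_q w(3) by fastforce
      qed
    qed
    obtain x' where x': "{?x, x'} \<in> E" "L x' = k"
      using parent[of ?x] Suc.prems(3,5) by auto
    obtain y' where y': "{?y, y'} \<in> E" "L y' = k"
      using parent[of ?y] Suc.prems(4,6) by auto
    have C': "x' \<in> C" "y' \<in> C"
      using x' y' closed Suc.prems(3,4) by blast+
    have "x' \<noteq> y'"
      using no_common_parent x' y' by blast
    have "{x', y'} \<in> E"
    proof -
      \<comment> \<open>All of \<open>q\<close> lies deeper than layer \<open>k\<close>, so the
        induction hypothesis applies to this walk between the two parents.\<close>
      let ?r = "x' # q @ [y']"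
      have "successively (\<lambda>u v. {u, v} \<in> E) ?r"
        using q x' y' by (auto simp: successively_append_iff successively_Cons insert_commute)
      then show ?thesis
        using Suc.IH[of ?r] C' x' y' \<open>x' \<noteq> y'\<close> layer_q by (auto simp: Suc_le_eq)
    qed
    have cross: "{?x, y'} \<notin> E" "{?y, x'} \<notin> E"
      using no_common_parent x' y' by blast+
    \<comment> \<open>A chord of this cycle would be a chord of \<open>q\<close>, or join a parent
      to an interior vertex at least two layers away, or join an end of \<open>q\<close> to the
      parent chosen for the other end, which would then be a common parent.\<close>
    let ?c = "q @ [y', x']"
    have "x' \<notin> set q" "y' \<notin> set q"
      using layer_q(1)[of x'] layer_q(1)[of y'] x' y' by auto
    then have "distinct ?c" using q \<open>x' \<noteq> y'\<close> by auto
    moreover have "successively (\<lambda>u v. {u, v} \<in> E) ?c"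
      using q y' \<open>{x', y'} \<in> E\<close> by (auto simp: successively_append_iff insert_commute)
    moreover have "{last ?c, hd ?c} \<in> E"
      using q x' by (simp add: insert_commute)
    ultimately obtain i j where ij: "i < j" "j < length ?c" "j \<noteq> Suc i"
        "\<not> (i = 0 \<and> Suc j = length ?c)" "{?c ! i, ?c ! j} \<in> E"
      using chordal_cycle_chord[OF chordal card_edge, of ?c] len by auto
    have no_inner: "{q ! i, w} \<notin> E" if "0 < i" "Suc i < length q" "L w = k" for i w
      using interior[of i] layer_Suc'[of "q ! i" w] layer_q that by fastforce
    consider "j < length q" | "j = length q" | "j = Suc (length q)"
      using ij by fastforce
    then show False
    proof cases
      case 1
      then show False using ij induced[of i j] by (simp add: nth_append)
    next
      case 2
      then have "{q ! i, y'} \<in> E" "Suc i < length q"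
        using ij by (auto simp: nth_append)
      then show False
        using no_inner y' cross ends by (cases "i = 0") auto
    next
      case 3
      then have i: "{q ! i, x'} \<in> E" "0 < i" "i < length q"
        using ij by (auto simp: nth_append less_Suc_eq split: if_splits)
      show False
      proof (cases "Suc i = length q")
        case True
        then have "i = length q - 1" by simp
        then show False using i cross ends by simp
      next
        case False
        then show False using no_inner i x' by auto
      qed
    qed
  qed
qed

lemma four_cycle_chord:
  assumes "{a, b} \<in> E" "{b, c} \<in> E" "{c, d} \<in> E" "{d, a} \<in> E" "a \<noteq> c" "b \<noteq> d"
  shows "{a, c} \<in> E \<or> {b, d} \<in> E"
proof -
  let ?c = "[a, b, c, d]"
  have "distinct ?c"
    using assms adjacent_neq by auto
  moreover have "4 \<le> length ?c" "successively (\<lambda>u v. {u, v} \<in> E) ?c" "{last ?c, hd ?c} \<in> E"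
    using assms by simp_all
  ultimately obtain i j where "i < j" "j < length ?c" "j \<noteq> Suc i" "\<not> (i = 0 \<and> Suc j = length ?c)"
      "{?c ! i, ?c ! j} \<in> E"
    using chordal_cycle_chord[OF chordal card_edge] by blast
  moreover from this have "i = 0 \<and> j = 2 \<or> i = 1 \<and> j = 3"
    by auto
  ultimately show ?thesis
    by auto
qed

text \<open>This and the next two lemmas are \<open>layer_walk_adjacent\<close> for walks that leave
  the layer of \<open>p\<close>, run through one, two or three vertices of the next layer and
  return.\<close>

lemma parents_adjacent:
  assumes "v \<in> C" "{v, p} \<in> E" "{v, q} \<in> E" "Suc (L p) = L v" "Suc (L q) = L v" "p \<noteq> q"
  shows "{p, q} \<in> E"
proof -
  have "p \<in> C" "q \<in> C"
    using assms closed by metis+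
  then show ?thesis
    using layer_walk_adjacent[of "[p, v, q]" "L p"] assms adjacent_sym[OF assms(2)] by simp
qed

lemma parents_of_adjacent_adjacent:
  assumes "u \<in> C" "{u, v} \<in> E" "L u = L v" "{u, p} \<in> E" "{v, q} \<in> E"
    "Suc (L p) = L u" "Suc (L q) = L v" "p \<noteq> q"
  shows "{p, q} \<in> E"
proof -
  have "v \<in> C" "p \<in> C" "q \<in> C"
    using assms closed by metis+
  then show ?thesis
    using layer_walk_adjacent[of "[p, u, v, q]" "L p"] assms adjacent_sym[OF assms(4)] by simp
qed

lemma parents_of_walk2_adjacent:
  assumes "u \<in> C" "{u, m} \<in> E" "{m, v} \<in> E" "L u = L m" "L m = L v" "{u, p} \<in> E" "{v, q} \<in> E"
    "Suc (L p) = L u" "Suc (L q) = L v" "p \<noteq> q"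
  shows "{p, q} \<in> E"
proof -
  have "m \<in> C" "v \<in> C" "p \<in> C" "q \<in> C"
    using assms closed by metis+
  then show ?thesis
    using layer_walk_adjacent[of "[p, u, m, v, q]" "L p"] assms adjacent_sym[OF assms(6)] by simp
qed

lemma siblings_adjacent:
  assumes "m \<in> C" "{u, m} \<in> E" "{m, v} \<in> E" "Suc (L u) = L m" "Suc (L v) = L m" "u \<noteq> v"
  shows "{u, v} \<in> E"
  using parents_adjacent[of m u v] assms adjacent_sym[OF assms(2)] by simp

lemma no_four_neighbours:
  assumes "finite {u. {v, u} \<in> E}" "vdegree E v \<le> 3"
    "{v, a} \<in> E" "{v, b} \<in> E" "{v, c} \<in> E" "{v, d} \<in> E" "distinct [a, b, c, d]"
  shows False
proof -
  have "card {a, b, c, d} \<le> vdegree E v"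
    unfolding vdegree_def using assms by (intro card_mono) auto
  then show False using assms by simp
qed

end

section \<open>Neighbourhoods of parents under degree at most 3\<close>

text \<open>Finiteness is stated separately since \<open>vdegree\<close> is a \<open>card\<close>,
  which is 0 for an infinite neighbourhood.\<close>

locale subcubic_chordal_layering = chordal_layering +
  assumes finite_nbrs: "\<And>v. finite {u. {v, u} \<in> E}"
    and degree_le: "\<And>v. vdegree E v \<le> 3"
begin

lemmas four = no_four_neighbours[OF finite_nbrs degree_le]

text \<open>If \<open>p\<close> missed \<open>x\<close>, a parent \<open>q\<close> of
  \<open>x\<close> would differ from \<open>p\<close> and be adjacent to it. The 4-cycle
  \<open>v\<close>, \<open>x\<close>, \<open>q\<close>, \<open>p\<close> would then make
  \<open>v\<close> adjacent to \<open>q\<close>, and together with a parent of \<open>q\<close> this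
  gives \<open>q\<close> four neighbours.\<close>

lemma adjacent_same_layer_parent:
  assumes v: "v \<in> C" "{v, p} \<in> E" "Suc (L p) = L v" and x: "{v, x} \<in> E" "L x = L v"
  shows "{p, x} \<in> E"
proof (rule ccontr)
  assume px: "{p, x} \<notin> E"
  have xC: "x \<in> C" using v x closed by blast
  obtain q where q: "{x, q} \<in> E" "Suc (L q) = L x"
    using parent[OF xC] v(3) x(2) by auto
  have "p \<noteq> q" using px q by (auto simp: insert_commute)
  then have pq: "{p, q} \<in> E"
    using parents_of_adjacent_adjacent[of v x p q] v x q by auto
  have pC: "p \<in> C" "q \<in> C" using closed v xC q by blast+
  \<comment> \<open>Two distinct vertices in one layer show that it is not layer 0, so
    \<open>q\<close> has a parent in turn.\<close>
  have "L p \<noteq> 0"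
    using root[OF pC] \<open>p \<noteq> q\<close> q(2) v(3) x(2) by linarith
  then obtain g where g: "{q, g} \<in> E" "Suc (L g) = L q"
    using parent[OF pC(2)] q v x by auto
  have "v \<noteq> q" "x \<noteq> p"
    using v q x by auto
  then have "{v, q} \<in> E"
    using four_cycle_chord[of v x q p] v x q pq px by (auto simp: insert_commute)
  moreover have "distinct [v, x, p, g]"
    using adjacent_neq v x q g by auto
  ultimately show False
    using four[of q v x p g] q g pq by (auto simp: insert_commute)
qed

text \<open>A neighbour of \<open>v\<close> that is not deeper either shares the layer of
  \<open>v\<close> or is another parent of \<open>v\<close>.\<close>

lemma adjacent_le_layer_parent:
  assumes v: "v \<in> C" "{v, p} \<in> E" "Suc (L p) = L v" and x: "{v, x} \<in> E" "L x \<le> L v" "x \<noteq> p"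
  shows "{p, x} \<in> E"
proof (cases "L x = L v")
  case True
  then show ?thesis using adjacent_same_layer_parent v x by blast
next
  case False
  then have "Suc (L x) = L v"
    using layer_Suc'[of v x] v x by auto
  then show ?thesis
    using parents_adjacent[of v p x] v x by auto
qed

lemma distance_two_le_layer_parent:
  assumes v: "v \<in> C" "{v, p} \<in> E" "Suc (L p) = L v"
    and x: "{v, m} \<in> E" "{m, x} \<in> E" "x \<noteq> v" "L x \<le> L v" "x \<noteq> p"
  shows "{p, x} \<in> E"
proof (cases "m = p")
  case True
  then show ?thesis using x by simp
next
  case False
  have C: "m \<in> C" "x \<in> C" "p \<in> C" using closed v x by blast+
  consider "Suc (L m) = L v" | "L m = L v" | "L m = Suc (L v)"
    using layer_Suc[of v m] layer_Suc'[of v m] v x by linarith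
  then show ?thesis
  proof cases
    \<comment> \<open>\<open>m\<close> is a second parent of \<open>v\<close>. Its neighbours are
      \<open>v\<close>, \<open>p\<close> and its own parent \<open>g\<close>, so \<open>x\<close> is
      \<open>g\<close>. If a parent \<open>h\<close> of \<open>p\<close> differs from
      \<open>g\<close>, the 4-cycle \<open>m\<close>, \<open>p\<close>, \<open>h\<close>,
      \<open>g\<close> must have the diagonal from \<open>p\<close> to \<open>g\<close>, because
      \<open>m\<close> has no room for \<open>h\<close>.\<close>
    case 1
    have mp: "{m, p} \<in> E" using parents_adjacent[of v m p] 1 v x False by auto
    have "L m \<noteq> 0" using root[OF C(1,3)] False 1 v(3) by linarith
    then obtain g where g: "{m, g} \<in> E" "Suc (L g) = L m"
      using parent C by blast
    obtain h where h: "{p, h} \<in> E" "Suc (L h) = L p"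
      using parent[OF C(3)] \<open>L m \<noteq> 0\<close> 1 v by auto
    have only: "w = v \<or> w = p \<or> w = g" if "{m, w} \<in> E" for w
    proof (rule ccontr)
      assume "\<not> ?thesis"
      moreover have "v \<noteq> p" "v \<noteq> g" "p \<noteq> g"
        using g 1 v by auto
      ultimately show False
        using four[of m v p g w] x mp g that by (auto simp: insert_commute)
    qed
    then have "x = g" using x by blast
    show ?thesis
    proof (cases "h = g")
      case True
      then show ?thesis using h \<open>x = g\<close> by simp
    next
      case False
      have "{g, h} \<in> E"
        using parents_of_adjacent_adjacent[of m p g h] C mp g h 1 v False by auto
      moreover have "m \<noteq> h" "p \<noteq> g"
        using g h 1 v by auto
      ultimately have "{m, h} \<in> E \<or> {p, g} \<in> E"
        using four_cycle_chord[of m p h g] mp g h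
        by (auto simp: insert_commute)
      moreover have "{m, h} \<notin> E"
        using only[of h] False h 1 v by auto
      ultimately show ?thesis using \<open>x = g\<close> by blast
    qed
  next
    \<comment> \<open>If \<open>x\<close> is less deep than \<open>m\<close>, then \<open>p\<close>
      and \<open>x\<close> are both parents of \<open>m\<close>. Otherwise a parent \<open>q\<close>
      of \<open>x\<close> other than \<open>p\<close> would be a fourth neighbour of
      \<open>p\<close>, besides \<open>v\<close>, \<open>m\<close> and a parent of
      \<open>p\<close>.\<close>
    case 2
    have mp: "{p, m} \<in> E" using adjacent_same_layer_parent v x 2 by blast
    show ?thesis
    proof (cases "L x = L v")
      case False
      then have "Suc (L x) = L m" using layer_Suc'[of m x] C x 2 by auto
      then show ?thesis
        using parents_adjacent[of m p x] C mp x v 2 by (auto simp: insert_commute)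
    next
      case True
      obtain q where q: "{x, q} \<in> E" "Suc (L q) = L x"
        using parent[OF C(2)] True v by auto
      show ?thesis
      proof (cases "q = p")
        case True
        then show ?thesis using q by (simp add: insert_commute)
      next
        case False
        have pq: "{p, q} \<in> E"
          using parents_of_walk2_adjacent[of v m x p q] v x q 2 True False by auto
        have "L p \<noteq> 0"
          using root[OF C(3), of q] closed[OF C(2) q(1)] False q(2) True v(3) by fastforce
        then obtain h where h: "{p, h} \<in> E" "Suc (L h) = L p"
          using parent C by blast
        have "distinct [v, m, q, h]"
          using adjacent_neq[OF x(1)] v q h 2 True by auto
        then show ?thesis
          using four[of p v m q h] v mp pq h by (auto simp: insert_commute)
      qed
    qed
  next
    \<comment> \<open>\<open>m\<close> is deeper, so \<open>v\<close> and \<open>x\<close> are both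
      parents of \<open>m\<close> and hence adjacent.\<close>
    case 3
    then have "Suc (L x) = L m" using layer_Suc'[of m x] C x by auto
    then have "{v, x} \<in> E"
      using siblings_adjacent[of m v x] 3 C x by auto
    then show ?thesis
      using adjacent_le_layer_parent v x by blast
  qed
qed

end

section \<open>Edges of the square\<close>

lemma neighbours_subset:
  assumes "simple_graph V E"
  shows "{u. {v, u} \<in> E} \<subseteq> V"
proof
  fix u
  assume "u \<in> {u. {v, u} \<in> E}"
  then have "{v, u} \<subseteq> V"
    using assms unfolding simple_graph_def by (metis mem_Collect_eq)
  then show "u \<in> V" by simp
qed

text \<open>Turns distance 1 or 2 into an edge or a common neighbour, so that paths and infima do
  not occur afterwards.\<close>

lemma square_edges_iff:
  assumes "simple_graph V E"
  shows "{u, v} \<in> square_edges V E \<longleftrightarrow> u \<noteq> v \<and> ({u, v} \<in> E \<or> (\<exists>m. {u, m} \<in> E \<and> {m, v} \<in> E))"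
    (is "_ \<longleftrightarrow> u \<noteq> v \<and> ?near u v")
proof -
  have edge: "x \<in> V \<and> y \<in> V \<and> x \<noteq> y" if "{x, y} \<in> E" for x y
    using assms that unfolding simple_graph_def by fastforce
  \<comment> \<open>A square edge is an unordered pair, so its defining distance may be given from
    \<open>v\<close> to \<open>u\<close>.\<close>
  have sym: "?near x y \<longleftrightarrow> ?near y x" for x y
    using insert_commute[of x y "{}"] insert_commute[of x _ "{}"] insert_commute[of _ y "{}"]
    by auto
  let ?P = "\<lambda>x y. {p. is_path V E p \<and> hd p = x \<and> last p = y}"
  have near: "?near x y" if d: "graph_dist V E x y \<in> {1, 2}" and "x \<noteq> y" for x y
  proof -
    \<comment> \<open>The infimum over no paths is \<open>\<infinity>\<close>. Hence some path
      exists, and then the infimum is attained by one.\<close>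
    have "?P x y \<noteq> {}"
    proof
      assume "?P x y = {}"
      then have "graph_dist V E x y = \<infinity>"
        unfolding graph_dist_def by (simp only: image_empty) (simp add: top_enat_def)
      then show False using d by auto
    qed
    then have "graph_dist V E x y \<in> (\<lambda>p. enat (length p - 1)) ` ?P x y"
      unfolding graph_dist_def by (metis (mono_tags, lifting) ex_in_conv image_is_empty wellorder_InfI)
    then obtain p where p: "is_path V E p" "hd p = x" "last p = y"
        "enat (length p - 1) \<in> {1, 2}"
      using d by auto
    then have "length p = 2 \<or> length p = 3"
      by (auto simp: one_enat_def numeral_eq_enat)
    then consider a b where "p = [a, b]" | a b c where "p = [a, b, c]"
      by (auto simp: numeral_eq_Suc length_Suc_conv)
    then show ?thesis
    proof cases
      case 1
      then show ?thesis using p unfolding is_path_def by auto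
    next
      case 2
      then have "{a, b} \<in> E" "{b, c} \<in> E"
        using p unfolding is_path_def by (force, force)
      then show ?thesis using p 2 by auto
    qed
  qed
  have dist: "graph_dist V E u v \<in> {1, 2}" if uv: "u \<noteq> v" "?near u v"
  proof -
    have "\<exists>p \<in> ?P u v. length p - 1 \<le> 2"
    proof (cases "{u, v} \<in> E")
      case True
      then show ?thesis
        using edge[OF True] by (intro bexI[of _ "[u, v]"]) (auto simp: is_path_def)
    next
      case False
      then obtain m where m: "{u, m} \<in> E" "{m, v} \<in> E"
        using uv by blast
      then show ?thesis
        using edge[OF m(1)] edge[OF m(2)] uv(1)
        by (intro bexI[of _ "[u, m, v]"]) (auto simp: is_path_def nth_Cons split: nat.splits)
    qed
    then have "graph_dist V E u v \<le> 2"
      unfolding graph_dist_def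
      by (smt (verit, best) INF_lower2 enat_ord_simps(1) numeral_eq_enat)
    moreover have "1 \<le> graph_dist V E u v"
      unfolding graph_dist_def
    proof (rule INF_greatest)
      fix p
      assume "p \<in> ?P u v"
      then have "p \<noteq> []" "hd p \<noteq> last p"
        using \<open>u \<noteq> v\<close> by (auto simp: is_path_def)
      then have "1 \<le> length p - 1"
        by (cases p; cases "tl p") auto
      then show "1 \<le> enat (length p - 1)"
        by (simp add: one_enat_def)
    qed
    ultimately show ?thesis
      by (cases "graph_dist V E u v") (auto simp: one_enat_def numeral_eq_enat)
  qed
  show ?thesis
  proof
    assume "{u, v} \<in> square_edges V E"
    then obtain x y where "{u, v} = {x, y}" "x \<noteq> y" "graph_dist V E x y \<in> {1, 2}"
      unfolding square_edges_def by blast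
    then show "u \<noteq> v \<and> ?near u v"
      using near[of x y] sym[of u v] by (auto simp: doubleton_eq_iff)
  next
    assume "u \<noteq> v \<and> ?near u v"
    then show "{u, v} \<in> square_edges V E"
      using dist edge unfolding square_edges_def by blast
  qed
qed

section \<open>Colouring, cliques and inductiveness\<close>

text \<open>Greedy colouring, inserting the low-degree vertices in reverse order of removal.\<close>

lemma degenerate_proper_coloring:
  assumes "finite V" and loop: "\<And>u. {u, u} \<notin> F"
    and low: "\<And>W. W \<subseteq> V \<Longrightarrow> W \<noteq> {} \<Longrightarrow> \<exists>v\<in>W. card {u \<in> W. {v, u} \<in> F} \<le> d"
  shows "\<exists>c. proper_coloring V F (Suc d) c"
proof -
  have "\<exists>c. proper_coloring W F (Suc d) c" if "W \<subseteq> V" for W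
    using finite_subset[OF that \<open>finite V\<close>] that
  proof (induction W rule: finite_psubset_induct)
    case (psubset W)
    show ?case
    proof (cases "W = {}")
      case True
      then show ?thesis by (simp add: proper_coloring_def)
    next
      case False
      obtain v where v: "v \<in> W" "card {u \<in> W. {v, u} \<in> F} \<le> d"
        using low[OF psubset.prems False] by blast
      obtain c where c: "proper_coloring (W - {v}) F (Suc d) c"
        using psubset.IH[of "W - {v}"] v psubset.prems by blast
      let ?N = "{u \<in> W. {v, u} \<in> F}"
      \<comment> \<open>At most \<open>d\<close> of the \<open>Suc d\<close> colours occur on the
        neighbours of \<open>v\<close>, so one is free for \<open>v\<close>.\<close>
      have "card (c ` ?N) < card {..<Suc d}"
        using v(2) card_image_le[of ?N c] psubset.hyps by simp
      then have "\<not> {..<Suc d} \<subseteq> c ` ?N"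
        using card_mono[of "c ` ?N" "{..<Suc d}"] psubset.hyps by fastforce
      then obtain a where a: "a < Suc d" "a \<notin> c ` ?N"
        by blast
      have "proper_coloring W F (Suc d) (c(v := a))"
        unfolding proper_coloring_def
      proof (intro conjI ballI impI)
        show "(c(v := a)) ` W \<subseteq> {..<Suc d}"
          using c a unfolding proper_coloring_def by auto
        fix x y
        assume xy: "x \<in> W" "y \<in> W" "{x, y} \<in> F"
        then have "{y, x} \<in> F" "x \<noteq> y" using loop by (auto simp: insert_commute)
        then show "(c(v := a)) x \<noteq> (c(v := a)) y"
          using c a xy unfolding proper_coloring_def by auto
      qed
      then show ?thesis by blast
    qed
  qed
  then show ?thesis by blast
qed

text \<open>A colouring is injective on a clique, and greedy colouring needs only
  \<open>Suc d\<close> colours; this pins down the first two numbers. For the third, every degree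
  inside \<open>K\<close> is \<open>d\<close>, the largest minimum degree that \<open>low\<close>
  permits.\<close>

lemma clique_chromatic_inductiveness_eq:
  assumes "finite V" and loop: "\<And>u. {u, u} \<notin> F"
    and low: "\<And>W. W \<subseteq> V \<Longrightarrow> W \<noteq> {} \<Longrightarrow> \<exists>v\<in>W. card {u \<in> W. {v, u} \<in> F} \<le> d"
    and K: "is_clique V F K" "card K = Suc d"
  shows "clique_number V F = Suc d" "chromatic_number V F = Suc d" "inductiveness V F = d"
proof -
  have finK: "finite K'" if "is_clique V F K'" for K'
    using that \<open>finite V\<close> finite_subset unfolding is_clique_def by blast
  have clique_le: "card K' \<le> k" if K': "is_clique V F K'" and c: "proper_coloring V F k c" for K' k c
  proof -
    have "inj_on c K'" "c ` K' \<subseteq> {..<k}"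
      using K' c unfolding is_clique_def proper_coloring_def inj_on_def by blast+
    then show ?thesis
      by (metis card_inj_on_le card_lessThan finite_lessThan)
  qed
  obtain c where c: "proper_coloring V F (Suc d) c"
    using degenerate_proper_coloring[OF \<open>finite V\<close> loop low] by blast
  show "chromatic_number V F = Suc d"
    unfolding chromatic_number_def
  proof (rule Least_equality)
    show "Suc d \<le> k" if "\<exists>c. proper_coloring V F k c" for k
      using that clique_le[OF K(1)] K(2) by metis
  qed (use c in blast)
  \<comment> \<open>The colouring \<open>c\<close> bounds all clique sizes; this also gives the
    finiteness that \<open>Max\<close> requires.\<close>
  have "{card K' |K'. is_clique V F K'} \<subseteq> {..Suc d}"
    using clique_le[OF _ c] by blast
  moreover from this have "finite {card K' |K'. is_clique V F K'}"
    using finite_subset by blast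
  ultimately show "clique_number V F = Suc d"
    unfolding clique_number_def using K
    by (intro Max_eqI) (blast, blast, metis (mono_tags, lifting) mem_Collect_eq)
  have degree: "vdegree (induced_edges F W) v = card {u \<in> W. {v, u} \<in> F}" if "v \<in> W" for v W
    using that unfolding vdegree_def induced_edges_def by (intro arg_cong[of _ _ card]) auto
  have min_le: "min_degree W (induced_edges F W) \<le> d" if W: "W \<subseteq> V" "W \<noteq> {}" for W
  proof -
    obtain v where v: "v \<in> W" "card {u \<in> W. {v, u} \<in> F} \<le> d"
      using low[OF W] by blast
    have "finite W" using W \<open>finite V\<close> finite_subset by blast
    then have "min_degree W (induced_edges F W) \<le> vdegree (induced_edges F W) v"
      unfolding min_degree_def using v by (intro Min_le) auto
    then show ?thesis using v degree by simp
  qed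
  have "vdegree (induced_edges F K) v = d" if "v \<in> K" for v
  proof -
    have "{u \<in> K. {v, u} \<in> F} = K - {v}"
      using K(1) that loop unfolding is_clique_def by auto
    then show ?thesis
      using degree[OF that] K(2) that finK[OF K(1)] by simp
  qed
  moreover have "K \<noteq> {}" using K(2) by auto
  ultimately have "vdegree (induced_edges F K) ` K = {d}"
    by auto
  then have "min_degree K (induced_edges F K) = d"
    by (simp add: min_degree_def)
  moreover have "finite {min_degree W (induced_edges F W) |W. W \<subseteq> V \<and> W \<noteq> {}}"
    using \<open>finite V\<close> by simp
  ultimately show "inductiveness V F = d"
    unfolding inductiveness_def using min_le K(1) \<open>K \<noteq> {}\<close>
    by (intro Max_eqI) (auto simp: is_clique_def)
qed

section \<open>Large cliques and low-degree vertices of the square\<close>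

text \<open>Any two neighbours of \<open>v\<close> have \<open>v\<close> as a common neighbour. For
  \<open>v\<close> of maximum degree this supplies the clique \<open>K\<close> of the preceding
  lemma.\<close>

lemma closed_neighbourhood_clique_square:
  assumes "simple_graph V E" "v \<in> V"
  shows "is_clique V (square_edges V E) (insert v {u. {v, u} \<in> E})"
proof -
  have "u \<in> V" if "{v, u} \<in> E" for u
    using assms that by (auto simp: simple_graph_def)
  moreover have "{u, v} \<in> E" if "{v, u} \<in> E" for u
    using that by (simp add: insert_commute)
  ultimately show ?thesis
    using assms(2) unfolding is_clique_def square_edges_iff[OF assms(1)] by blast
qed

text \<open>For a parent \<open>p\<close> of \<open>v\<close>, the square neighbours of
  \<open>v\<close> in \<open>W\<close> lie in the closed neighbourhood of \<open>p\<close>. Counting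
  \<open>p\<close> and leaving out \<open>v\<close> balance, so there are at most
  \<open>vdegree E p\<close> of them.\<close>

lemma (in subcubic_chordal_layering) deepest_square_degree_le:
  assumes "simple_graph V E" and v: "v \<in> C" and deepest: "\<And>u. u \<in> W \<inter> C \<Longrightarrow> L u \<le> L v"
    and \<Delta>: "\<And>p. vdegree E p \<le> \<Delta>"
  shows "card {u \<in> W. {v, u} \<in> square_edges V E} \<le> \<Delta>"
proof -
  let ?N = "{u \<in> W. {v, u} \<in> square_edges V E}"
  have near: "u \<noteq> v" "{v, u} \<in> E \<or> (\<exists>m. {v, m} \<in> E \<and> {m, u} \<in> E)" "L u \<le> L v" "u \<in> C"
    if "u \<in> ?N" for u
  proof -
    show *: "u \<noteq> v" "{v, u} \<in> E \<or> (\<exists>m. {v, m} \<in> E \<and> {m, u} \<in> E)"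
      using that square_edges_iff[OF assms(1), of v u] by auto
    then show "u \<in> C" using closed v by blast
    then show "L u \<le> L v" using deepest that by blast
  qed
  show ?thesis
  proof (cases "L v = 0")
    case True
    \<comment> \<open>Only \<open>v\<close> lies in layer 0, and by \<open>deepest\<close> a square
      neighbour of \<open>v\<close> in \<open>W\<close> would lie there too.\<close>
    then have "?N = {}"
      using near root v by (metis (no_types, lifting) all_not_in_conv le_zero_eq)
    then show ?thesis by (metis card.empty le0)
  next
    case False
    then obtain p where p: "{v, p} \<in> E" "Suc (L p) = L v"
      using parent v by blast
    let ?M = "insert p ({u. {p, u} \<in> E} - {v})"
    have "?N \<subseteq> ?M"
      using near adjacent_le_layer_parent[OF v p] distance_two_le_layer_parent[OF v p] by blast
    then have "card ?N \<le> card ?M"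
      using finite_nbrs by (intro card_mono) auto
    also have "\<dots> \<le> Suc (card ({u. {p, u} \<in> E} - {v}))"
      by (simp add: card_insert_le_m1 card_insert_if finite_nbrs)
    also have "\<dots> = vdegree E p"
      unfolding vdegree_def using adjacent_sym[OF p(1)] finite_nbrs
      by (intro card_Suc_Diff1) auto
    finally show ?thesis using \<Delta>[of p] by simp
  qed
qed

lemma subcubic_chordal_square_degenerate:
  assumes "finite V" "simple_graph V E" "chordal E" "W \<subseteq> V" "W \<noteq> {}"
    and \<Delta>: "\<And>v. vdegree E v \<le> \<Delta>" "\<Delta> \<le> 3"
  shows "\<exists>v\<in>W. card {u \<in> W. {v, u} \<in> square_edges V E} \<le> \<Delta>"
proof -
  \<comment> \<open>Taking the root in \<open>W\<close> makes \<open>W \<inter> C\<close> nonempty,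
    so that it has a deepest vertex.\<close>
  obtain r where r: "r \<in> W" using assms by blast
  \<comment> \<open>\<open>R ^^ n\<close> relates the ends of walks with \<open>n\<close> edges. So
    \<open>C\<close> is the component of \<open>r\<close>, and on it \<open>L\<close> is the
    distance from \<open>r\<close>.\<close>
  define R where "R = {(u, v). {u, v} \<in> E}"
  define C where "C = {v. \<exists>n. (r, v) \<in> R ^^ n}"
  define L where "L v = (LEAST n. (r, v) \<in> R ^^ n)" for v
  have L: "(r, v) \<in> R ^^ L v" if "v \<in> C" for v
    using that unfolding C_def L_def by (auto intro: LeastI)
  have L_le: "L v \<le> n" if "(r, v) \<in> R ^^ n" for v n
    using that unfolding L_def by (rule Least_le)
  have step: "(r, v) \<in> R ^^ Suc n" if "(r, u) \<in> R ^^ n" "{u, v} \<in> E" for u v n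
    using that by (auto simp: R_def)
  interpret subcubic_chordal_layering E C L
  proof
    show "chordal E" by fact
    show "card e = 2" if "e \<in> E" for e
      using assms(2) that by (auto simp: simple_graph_def)
    show "v \<in> C" if "u \<in> C" "{u, v} \<in> E" for u v
      using step[OF L that(2)] that(1) unfolding C_def by blast
    show "L v \<le> Suc (L u)" if "u \<in> C" "{u, v} \<in> E" for u v
      using step[OF L that(2)] that(1) L_le by blast
    show "\<exists>w. {u, w} \<in> E \<and> Suc (L w) = L u" if u: "u \<in> C" "L u \<noteq> 0" for u
    proof -
      obtain n where n: "L u = Suc n" using u by (cases "L u") auto
      then obtain w where w: "(r, w) \<in> R ^^ n" "{w, u} \<in> E"
        using L[OF u(1)] by (auto simp: R_def)
      then have "w \<in> C" by (auto simp: C_def)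
      \<comment> \<open>A walk to \<open>w\<close> with fewer than \<open>n\<close> edges would
        extend to a walk to \<open>u\<close> that is shorter than \<open>L u\<close>.\<close>
      then have "L u \<le> Suc (L w)"
        using step[OF L w(2)] L_le by blast
      then show ?thesis
        using L_le[OF w(1)] n w(2) by (intro exI[of _ w]) (auto simp: insert_commute)
    qed
    show "u = v" if "u \<in> C" "v \<in> C" "L u = 0" "L v = 0" for u v
      using L[OF that(1)] L[OF that(2)] unfolding that(3,4) by simp
    show "finite {u. {v, u} \<in> E}" for v
      using neighbours_subset[OF assms(2)] assms(1) finite_subset by metis
    show "vdegree E v \<le> 3" for v
      using \<Delta> le_trans by blast
  qed
  have "r \<in> C" unfolding C_def by (auto intro: exI[of _ 0])
  moreover have "finite (W \<inter> C)"
    using assms finite_subset by blast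
  ultimately have fin: "finite (L ` (W \<inter> C))" "L ` (W \<inter> C) \<noteq> {}"
    using r by auto
  then obtain v where v: "v \<in> W \<inter> C" "L v = Max (L ` (W \<inter> C))"
    using Max_in by (metis image_iff)
  then have "L u \<le> L v" if "u \<in> W \<inter> C" for u
    using Max_ge[OF fin(1)] that by simp
  then show ?thesis
    using deepest_square_degree_le[OF assms(2), of v W \<Delta>] v(1) \<Delta>(1) by blast
qed

theorem theorem4p3:
  fixes V :: "'a set" and E :: "'a set set" and \<Delta> :: nat
  assumes "finite V"
    and "simple_graph V E"
    and "chordal E"
    and "outerplanar V E"
    and "max_degree V E = \<Delta>"
    and "\<Delta> \<in> {2, 3}"
  shows "clique_number V (square_edges V E) = chromatic_number V (square_edges V E) \<and>
         chromatic_number V (square_edges V E) = inductiveness V (square_edges V E) + 1 \<and>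
         inductiveness V (square_edges V E) + 1 = \<Delta> + 1"
proof -
  let ?F = "square_edges V E"
  \<comment> \<open>The supremum of the empty set of naturals is 0, so an empty \<open>V\<close>
    would give \<open>\<Delta> = 0\<close>.\<close>
  have "V \<noteq> {}"
    using assms(5,6) by (auto simp: max_degree_def)
  then have max: "\<Delta> = Max (vdegree E ` V)"
    using assms(1,5) by (simp add: max_degree_def cSup_eq_Max)
  then obtain v where v: "v \<in> V" "vdegree E v = \<Delta>"
    using Max_in[of "vdegree E ` V"] \<open>V \<noteq> {}\<close> assms(1)
    by (metis finite_imageI image_iff image_is_empty)
  \<comment> \<open>The bound is wanted for every element of the type; those outside
    \<open>V\<close> lie on no edge and have degree 0.\<close>
  have degree: "vdegree E u \<le> \<Delta>" for u
  proof (cases "u \<in> V")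
    case True
    then show ?thesis using max assms(1) by simp
  next
    case False
    then have "{w. {u, w} \<in> E} = {}"
      using assms(2) by (auto simp: simple_graph_def)
    then show ?thesis by (simp add: vdegree_def)
  qed
  have low: "\<exists>v\<in>W. card {u \<in> W. {v, u} \<in> ?F} \<le> \<Delta>" if "W \<subseteq> V" "W \<noteq> {}" for W
    using subcubic_chordal_square_degenerate[OF assms(1-3) that degree] assms(6) by auto
  have loop: "{u, u} \<notin> ?F" for u
    using square_edges_iff[OF assms(2), of u u] by simp
  \<comment> \<open>As \<open>v\<close> attains the maximum degree, this clique of the square has
    \<open>Suc \<Delta>\<close> vertices.\<close>
  let ?K = "insert v {u. {v, u} \<in> E}"
  have "finite {u. {v, u} \<in> E}"
    using neighbours_subset[OF assms(2)] assms(1) finite_subset by metis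
  moreover have "v \<notin> {u. {v, u} \<in> E}"
    using assms(2) by (auto simp: simple_graph_def)
  ultimately have "card ?K = Suc \<Delta>"
    using v(2) by (simp add: vdegree_def)
  from clique_chromatic_inductiveness_eq[OF assms(1) loop low
      closed_neighbourhood_clique_square[OF assms(2) v(1)] this]
  show ?thesis by simp
qed

end
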